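(* Let $\alpha,\beta,\gamma,\delta\in\mathcal{L}$ be Lipschitz integers. Then $$(\alpha\beta)\times(\alpha\gamma)\times\delta=\alpha\,\bigl(\beta\times\gamma\times(\bar{\alpha}\delta)\bigr)\in\alpha\mathcal{L},$$ $$(\beta\alpha)\times(\gamma\alpha)\times\delta=\bigl(\beta\times\gamma\times(\delta\bar{\alpha})\bigr)\,\alpha\in\mathcal{L}\alpha .$$
   Context: $\mathbb{H}$ is the real quaternion algebra with basis $1,i,j,k$ ($i^2=j^2=k^2=ijk=-1$), identified with $\mathbb{R}^4$ via $(1,i,j,k)=(\mathbf{e}_1,\mathbf{e}_2,\mathbf{e}_3,\mathbf{e}_4)$; $\bar{u}$ denotes the quaternion conjugate. $\mathcal{L}=\mathbb{Z}+\mathbb{Z}i+\mathbb{Z}j+\mathbb{Z}k$ is the ring of Lipschitz integers; $\alpha\mathcal{L}=\{\alpha x: x\in\mathcal{L}\}$ and $\mathcal{L}\alpha=\{x\alpha: x\in\mathcal{L}\}$. The ternary vector product of $u,v,w\in\mathbb{H}$, with $u=u_0+u_1i+u_2j+u_3k$ and similarly for $v,w$, is $$u\times v\times w=\begin{vmatrix}u_0&u_1&u_2&u_3\\ v_0&v_1&v_2&v_3\\ w_0&w_1&w_2&w_3\\ 1&i&j&k\end{vmatrix},$$ the formal determinant being computed by Laplace expansion along the last row. *)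

theory Defs
  imports "HOL-Analysis.Analysis"
begin

text \<open>The real quaternion algebra. A quaternion is given by its coordinates
  \<open>Q0, Q1, Q2, Q3\<close> in the basis 1, i, j, k.\<close>

codatatype quat = Quat (Q0: real) (Q1: real) (Q2: real) (Q3: real)

lemma quat_eqI: "\<lbrakk>Q0 x = Q0 y; Q1 x = Q1 y; Q2 x = Q2 y; Q3 x = Q3 y\<rbrakk> \<Longrightarrow> x = y"
  by (rule quat.expand) simp

lemma quat_eq_iff: "x = y \<longleftrightarrow> Q0 x = Q0 y \<and> Q1 x = Q1 y \<and> Q2 x = Q2 y \<and> Q3 x = Q3 y"
  by (auto intro: quat_eqI)

instantiation quat :: real_algebra_1
begin

primcorec zero_quat where
  "Q0 0 = 0" | "Q1 0 = 0" | "Q2 0 = 0" | "Q3 0 = 0"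

primcorec one_quat where
  "Q0 1 = 1" | "Q1 1 = 0" | "Q2 1 = 0" | "Q3 1 = 0"

primcorec plus_quat where
  "Q0 (x + y) = Q0 x + Q0 y"
| "Q1 (x + y) = Q1 x + Q1 y"
| "Q2 (x + y) = Q2 x + Q2 y"
| "Q3 (x + y) = Q3 x + Q3 y"

primcorec uminus_quat where
  "Q0 (- x) = - Q0 x"
| "Q1 (- x) = - Q1 x"
| "Q2 (- x) = - Q2 x"
| "Q3 (- x) = - Q3 x"

primcorec minus_quat where
  "Q0 (x - y) = Q0 x - Q0 y"
| "Q1 (x - y) = Q1 x - Q1 y"
| "Q2 (x - y) = Q2 x - Q2 y"
| "Q3 (x - y) = Q3 x - Q3 y"

primcorec scaleR_quat where
  "Q0 (r *\<^sub>R x) = r * Q0 x"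
| "Q1 (r *\<^sub>R x) = r * Q1 x"
| "Q2 (r *\<^sub>R x) = r * Q2 x"
| "Q3 (r *\<^sub>R x) = r * Q3 x"

primcorec times_quat where
  "Q0 (x * y) = Q0 x * Q0 y - Q1 x * Q1 y - Q2 x * Q2 y - Q3 x * Q3 y"
| "Q1 (x * y) = Q0 x * Q1 y + Q1 x * Q0 y + Q2 x * Q3 y - Q3 x * Q2 y"
| "Q2 (x * y) = Q0 x * Q2 y - Q1 x * Q3 y + Q2 x * Q0 y + Q3 x * Q1 y"
| "Q3 (x * y) = Q0 x * Q3 y + Q1 x * Q2 y - Q2 x * Q1 y + Q3 x * Q0 y"

instance
  by standard (simp_all add: quat_eq_iff algebra_simps)

end

definition qi :: quat where "qi = Quat 0 1 0 0"
definition qj :: quat where "qj = Quat 0 0 1 0"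
definition qk :: quat where "qk = Quat 0 0 0 1"

lemma quat_units_mult:
  "qi * qi = - 1" "qj * qj = - 1" "qk * qk = - 1" "qi * qj * qk = - 1"
  by (simp_all add: quat_eq_iff qi_def qj_def qk_def)

lemma quat_expansion:
  "x = Q0 x *\<^sub>R 1 + Q1 x *\<^sub>R qi + Q2 x *\<^sub>R qj + Q3 x *\<^sub>R qk"
  by (simp add: quat_eq_iff qi_def qj_def qk_def)

definition qcnj :: "quat \<Rightarrow> quat" where
  "qcnj u = Quat (Q0 u) (- Q1 u) (- Q2 u) (- Q3 u)"

definition lipschitz_integers :: "quat set" where
  "lipschitz_integers =
     {of_int a + of_int b * qi + of_int c * qj + of_int d * qk | a b c d. True}"

text \<open>The formal determinant with rows \<open>u\<close>, \<open>v\<close>, \<open>w\<close> and \<open>(1, i, j, k)\<close>, expanded along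
  its last row: the cofactor signs are \<open>-, +, -, +\<close>, and each minor omits one coordinate.\<close>

definition ternary_product :: "quat \<Rightarrow> quat \<Rightarrow> quat \<Rightarrow> quat" where
  "ternary_product u v w =
     - (det (vector [vector [Q1 u, Q2 u, Q3 u],
                     vector [Q1 v, Q2 v, Q3 v],
                     vector [Q1 w, Q2 w, Q3 w]] :: real^3^3) *\<^sub>R 1)
     + det (vector [vector [Q0 u, Q2 u, Q3 u],
                    vector [Q0 v, Q2 v, Q3 v],
                    vector [Q0 w, Q2 w, Q3 w]] :: real^3^3) *\<^sub>R qi
     - det (vector [vector [Q0 u, Q1 u, Q3 u],
                    vector [Q0 v, Q1 v, Q3 v],
                    vector [Q0 w, Q1 w, Q3 w]] :: real^3^3) *\<^sub>R qj
     + det (vector [vector [Q0 u, Q1 u, Q2 u],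
                    vector [Q0 v, Q1 v, Q2 v],
                    vector [Q0 w, Q1 w, Q2 w]] :: real^3^3) *\<^sub>R qk"

end

theory Submission imports Defs begin

text \<open>The ternary product is half of a difference of two triple products,
  \<open>(w * qcnj v * u - u * qcnj v * w) / 2\<close>. Both identities follow from this formula, since
  \<open>qcnj\<close> reverses products and \<open>\<alpha> * qcnj \<alpha> = qcnj \<alpha> * \<alpha>\<close> is a real number, hence central.\<close>

lemma qcnj_sel [simp]:
  "Q0 (qcnj u) = Q0 u" "Q1 (qcnj u) = - Q1 u" "Q2 (qcnj u) = - Q2 u" "Q3 (qcnj u) = - Q3 u"
  by (simp_all add: qcnj_def)

lemma quat_unit_sel [simp]:
  "Q0 qi = 0" "Q1 qi = 1" "Q2 qi = 0" "Q3 qi = 0"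
  "Q0 qj = 0" "Q1 qj = 0" "Q2 qj = 1" "Q3 qj = 0"
  "Q0 qk = 0" "Q1 qk = 0" "Q2 qk = 0" "Q3 qk = 1"
  by (simp_all add: qi_def qj_def qk_def)

lemma qcnj_mult: "qcnj (u * v) = qcnj v * qcnj u"
  by (simp add: quat_eq_iff algebra_simps)

definition qnorm2 :: "quat \<Rightarrow> real" where
  "qnorm2 u = (Q0 u)\<^sup>2 + (Q1 u)\<^sup>2 + (Q2 u)\<^sup>2 + (Q3 u)\<^sup>2"

lemma qcnj_mult_self: "qcnj u * u = of_real (qnorm2 u)"
  by (simp add: quat_eq_iff qnorm2_def of_real_def power2_eq_square)

lemma mult_qcnj_self: "u * qcnj u = of_real (qnorm2 u)"
  by (simp add: quat_eq_iff qnorm2_def of_real_def power2_eq_square)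

lemma ternary_product_sel:
  "Q0 (ternary_product u v w) =
    - det (vector [vector [Q1 u, Q2 u, Q3 u], vector [Q1 v, Q2 v, Q3 v],
                   vector [Q1 w, Q2 w, Q3 w]] :: real^3^3)"
  "Q1 (ternary_product u v w) =
    det (vector [vector [Q0 u, Q2 u, Q3 u], vector [Q0 v, Q2 v, Q3 v],
                 vector [Q0 w, Q2 w, Q3 w]] :: real^3^3)"
  "Q2 (ternary_product u v w) =
    - det (vector [vector [Q0 u, Q1 u, Q3 u], vector [Q0 v, Q1 v, Q3 v],
                   vector [Q0 w, Q1 w, Q3 w]] :: real^3^3)"
  "Q3 (ternary_product u v w) =
    det (vector [vector [Q0 u, Q1 u, Q2 u], vector [Q0 v, Q1 v, Q2 v],
                 vector [Q0 w, Q1 w, Q2 w]] :: real^3^3)"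
  by (simp_all add: ternary_product_def)

text \<open>In \<open>w * qcnj v * u - u * qcnj v * w\<close> the part symmetric in \<open>u\<close>
  and \<open>w\<close> cancels and the antisymmetric part appears twice, hence the factor 1/2. That
  the result is the determinant is a polynomial identity in each coordinate.\<close>

lemma ternary_product_eq:
  "ternary_product u v w = (1/2) *\<^sub>R (w * qcnj v * u - u * qcnj v * w)"
  by (simp add: quat_eq_iff ternary_product_sel det_3 algebra_simps)

lemma ternary_product_mult_left:
  "ternary_product (a * b) (a * c) d = a * ternary_product b c (qcnj a * d)"
proof -
  \<comment> \<open>Only this product needs centrality: reversal puts \<open>qcnj a\<close> next to
    \<open>a\<close>, and the resulting real number moves to the front, where it is split again as
    \<open>a * qcnj a\<close>. The other product, \<open>a * b * qcnj c * qcnj a * d\<close>,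
    already has the right shape up to associativity.\<close>
  have "d * qcnj (a * c) * (a * b) = d * qcnj c * (qcnj a * a) * b"
    by (simp add: qcnj_mult mult.assoc)
  also have "\<dots> = a * qcnj a * (d * qcnj c * b)"
    by (simp add: qcnj_mult_self mult_qcnj_self of_real_def)
  finally show ?thesis
    by (simp add: ternary_product_eq qcnj_mult right_diff_distrib mult.assoc)
qed

lemma ternary_product_mult_right:
  "ternary_product (b * a) (c * a) d = ternary_product b c (d * qcnj a) * a"
proof -
  \<comment> \<open>Mirror image: now the subtracted product contains the real factor, which moves
    to the far right to supply \<open>qcnj a * a\<close>.\<close>
  have "b * a * qcnj (c * a) * d = b * (a * qcnj a) * qcnj c * d"
    by (simp add: qcnj_mult mult.assoc)
  also have "\<dots> = b * qcnj c * d * (qcnj a * a)"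
    by (simp add: qcnj_mult_self mult_qcnj_self of_real_def)
  finally show ?thesis
    by (simp add: ternary_product_eq qcnj_mult left_diff_distrib mult.assoc)
qed

lemma of_int_quat: "of_int n = Quat (of_int n) 0 0 0"
proof -
  \<comment> \<open>Passing through \<open>of_real\<close> turns the integer into a scalar multiple
    of 1, whose coordinates are known.\<close>
  have "(of_int n :: quat) = of_int n *\<^sub>R 1"
    using of_real_of_int_eq [of n, where 'a = quat] by (simp only: of_real_def)
  then show ?thesis
    by (simp add: quat_eq_iff)
qed

text \<open>Reduces closure properties to those of the ring \<int>, one coordinate at a
  time.\<close>

lemma lipschitz_integers_iff:
  "x \<in> lipschitz_integers \<longleftrightarrow> Q0 x \<in> \<int> \<and> Q1 x \<in> \<int> \<and> Q2 x \<in> \<int> \<and> Q3 x \<in> \<int>"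
proof -
  have coords: "of_int a + of_int b * qi + of_int c * qj + of_int d * qk = Quat a b c d"
    for a b c d :: int
    by (simp add: quat_eq_iff of_int_quat)
  show ?thesis
    unfolding lipschitz_integers_def coords
    by (auto simp: quat_eq_iff elim!: Ints_cases)
qed

lemma lipschitz_integers_mult:
  "x \<in> lipschitz_integers \<Longrightarrow> y \<in> lipschitz_integers \<Longrightarrow> x * y \<in> lipschitz_integers"
  by (simp add: lipschitz_integers_iff)

lemma lipschitz_integers_qcnj: "x \<in> lipschitz_integers \<Longrightarrow> qcnj x \<in> lipschitz_integers"
  by (simp add: lipschitz_integers_iff)

text \<open>Integrality is read off the determinants; the formula with the factor 1/2 would hide
  it.\<close>

lemma lipschitz_integers_ternary_product:
  "u \<in> lipschitz_integers \<Longrightarrow> v \<in> lipschitz_integers \<Longrightarrow> w \<in> lipschitz_integers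
    \<Longrightarrow> ternary_product u v w \<in> lipschitz_integers"
  by (simp add: lipschitz_integers_iff ternary_product_sel det_3)

theorem theorem5p6:
  fixes \<alpha> \<beta> \<gamma> \<delta> :: quat
  assumes "\<alpha> \<in> lipschitz_integers" and "\<beta> \<in> lipschitz_integers"
    and "\<gamma> \<in> lipschitz_integers" and "\<delta> \<in> lipschitz_integers"
  shows "ternary_product (\<alpha> * \<beta>) (\<alpha> * \<gamma>) \<delta> = \<alpha> * ternary_product \<beta> \<gamma> (qcnj \<alpha> * \<delta>)
       \<and> \<alpha> * ternary_product \<beta> \<gamma> (qcnj \<alpha> * \<delta>) \<in> {\<alpha> * x | x. x \<in> lipschitz_integers}
       \<and> ternary_product (\<beta> * \<alpha>) (\<gamma> * \<alpha>) \<delta> = ternary_product \<beta> \<gamma> (\<delta> * qcnj \<alpha>) * \<alpha>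
       \<and> ternary_product \<beta> \<gamma> (\<delta> * qcnj \<alpha>) * \<alpha> \<in> {x * \<alpha> | x. x \<in> lipschitz_integers}"
proof -
  \<comment> \<open>These two products are the witnesses \<open>x\<close> for the two membership
    claims.\<close>
  have "ternary_product \<beta> \<gamma> (qcnj \<alpha> * \<delta>) \<in> lipschitz_integers"
    "ternary_product \<beta> \<gamma> (\<delta> * qcnj \<alpha>) \<in> lipschitz_integers"
    by (intro lipschitz_integers_ternary_product lipschitz_integers_mult
        lipschitz_integers_qcnj assms)+
  then show ?thesis
    using ternary_product_mult_left ternary_product_mult_right by blast
qed

end
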